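(* Let $\mathcal{H}$ be a separable right quaternionic Hilbert space with a fixed orthonormal basis $\{e_n:n\in\mathbb{N}\}$, let $q\in\mathbb{H}$ and $\varepsilon>0$, and let $L_q$ be the left multiplication operator $L_q(x)=\sum_{n\in\mathbb{N}}e_n\, q\,\langle e_n,x\rangle$ on $\mathcal{H}$. Then $$\Lambda_\varepsilon^S(L_q)=S^{\mathbb{H}}([q],\varepsilon).$$ In particular, if $q\in\mathbb{R}$, then $\Lambda_\varepsilon^S(L_q)=\Omega_{D(q,\sqrt{\varepsilon})}$, where $D(q,r)=\{z\in\mathbb{C}:|z-q|\le r\}$ is the closed disc in the complex plane.
   Context: $\mathbb{H}$ is the division ring of real quaternions, with $\mathbb{C}=\mathbb{R}+\mathbb{R}i\subset\mathbb{H}$; $\mathrm{Re}(q)$, $\mathrm{Im}(q)=q-\mathrm{Re}(q)$ and $|q|$ denote the real part, imaginary part and modulus of $q\in\mathbb{H}$. $\mathbb{S}=\{m\in\mathbb{H}: m^2=-1\}$ is the sphere of imaginary units. The similarity class of $q$ is $[q]=\{\mathrm{Re}(q)+m|\mathrm{Im}(q)|: m\in\mathbb{S}\}$. For $X\subseteq\mathbb{C}$ nonempty, its circularization is $\Omega_X=\{\alpha+\beta m:\ \alpha,\beta\in\mathbb{R},\ \alpha+\beta i\in X,\ m\in\mathbb{S}\}$. A right quaternionic Hilbert space is a right $\mathbb{H}$-module with an $\mathbb{H}$-valued inner product (positive definite, right $\mathbb{H}$-linear in the second variable, $\langle x,y\rangle=\overline{\langle y,x\rangle}$), complete in the induced norm.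 $\mathcal{B}(\mathcal{H})$ is the real Banach algebra of bounded right $\mathbb{H}$-linear operators on $\mathcal{H}$ with the operator norm. For $T\in\mathcal{B}(\mathcal{H})$ and $p\in\mathbb{H}$ put $Q_p(T)=T^2-2\,\mathrm{Re}(p)T+|p|^2I$. The $S$-spectrum is $\sigma_S(T)=\{p\in\mathbb{H}: Q_p(T)\text{ is not invertible in }\mathcal{B}(\mathcal{H})\}$. For $\varepsilon>0$ the pseudo $S$-spectrum is $\Lambda_\varepsilon^S(T)=\sigma_S(T)\cup\{p\in\mathbb{H}\setminus\sigma_S(T): \|Q_p(T)^{-1}\|\ge 1/\varepsilon\}$. For a compact set $K\subseteq\mathbb{H}$ and $\varepsilon>0$, $S^{\mathbb{H}}(K,\varepsilon)=\{p\in\mathbb{H}:\ \inf_{\mu\in K\cap\mathbb{C}}|\mu^2-2\mathrm{Re}(p)\mu+|p|^2|\le\varepsilon\}$. *)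

theory Defs
  imports "HOL-Analysis.Analysis"
begin

section \<open>Quaternions\<close>

datatype quat = Quat (qRe: real) (qIm1: real) (qIm2: real) (qIm3: real)

lemma quat_eq_iff:
  "x = y \<longleftrightarrow> qRe x = qRe y \<and> qIm1 x = qIm1 y \<and> qIm2 x = qIm2 y \<and> qIm3 x = qIm3 y"
  by (auto intro: quat.expand)

instantiation quat :: real_vector
begin

definition "0 = Quat 0 0 0 0"

definition "x + y = Quat (qRe x + qRe y) (qIm1 x + qIm1 y) (qIm2 x + qIm2 y) (qIm3 x + qIm3 y)"

definition "- x = Quat (- qRe x) (- qIm1 x) (- qIm2 x) (- qIm3 x)"

definition "x - y = Quat (qRe x - qRe y) (qIm1 x - qIm1 y) (qIm2 x - qIm2 y) (qIm3 x - qIm3 y)"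

definition "r *\<^sub>R x = Quat (r * qRe x) (r * qIm1 x) (r * qIm2 x) (r * qIm3 x)"

lemmas quat_vector_defs =
  zero_quat_def plus_quat_def uminus_quat_def minus_quat_def scaleR_quat_def

instance
  by standard (simp_all add: quat_vector_defs quat_eq_iff algebra_simps)

end

instantiation quat :: real_inner
begin

definition "inner x y = qRe x * qRe y + qIm1 x * qIm1 y + qIm2 x * qIm2 y + qIm3 x * qIm3 y"

definition "norm (x :: quat) = sqrt (inner x x)"

definition "dist (x :: quat) y = norm (x - y)"

definition "sgn (x :: quat) = inverse (norm x) *\<^sub>R x"

definition "(uniformity :: (quat \<times> quat) filter) = (INF e\<in>{0<..}. principal {(x, y). dist x y < e})"

definition "open (U :: quat set) \<longleftrightarrow> (\<forall>x\<in>U. eventually (\<lambda>(x', y). x' = x \<longrightarrow> y \<in> U) uniformity)"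

instance
proof
  fix x y z :: quat and r s :: real
  show "0 \<le> inner x x" by (simp add: inner_quat_def)
  show "inner x x = 0 \<longleftrightarrow> x = 0"
    unfolding inner_quat_def zero_quat_def quat_eq_iff
    by (smt (verit) mult_eq_0_iff quat.sel zero_le_square)
  show "norm x = sqrt (inner x x)" by (rule norm_quat_def)
  show "dist x y = norm (x - y)" by (rule dist_quat_def)
  show "sgn x = x /\<^sub>R norm x" by (rule sgn_quat_def)
  show "(uniformity :: (quat \<times> quat) filter) = (INF e\<in>{0<..}. principal {(x, y). dist x y < e})"
    by (rule uniformity_quat_def)
  show "open U \<longleftrightarrow> (\<forall>x\<in>U. eventually (\<lambda>(x', y). x' = x \<longrightarrow> y \<in> U) uniformity)" for U :: "quat set"
    by (rule open_quat_def)
qed (simp_all add: inner_quat_def quat_vector_defs algebra_simps)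

end

lemma norm_sq_quat: "(norm x)\<^sup>2 = (qRe x)\<^sup>2 + (qIm1 x)\<^sup>2 + (qIm2 x)\<^sup>2 + (qIm3 x)\<^sup>2"
  by (simp add: norm_eq_sqrt_inner inner_quat_def power2_eq_square)

instantiation quat :: real_normed_algebra_1
begin

definition "1 = Quat 1 0 0 0"

text \<open>The Hamilton product, with basis \<open>1, i, j, k\<close> and \<open>i j = k = - (j i)\<close>.\<close>

definition "x * y = Quat
  (qRe x * qRe y - qIm1 x * qIm1 y - qIm2 x * qIm2 y - qIm3 x * qIm3 y)
  (qRe x * qIm1 y + qIm1 x * qRe y + qIm2 x * qIm3 y - qIm3 x * qIm2 y)
  (qRe x * qIm2 y - qIm1 x * qIm3 y + qIm2 x * qRe y + qIm3 x * qIm1 y)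
  (qRe x * qIm3 y + qIm1 x * qIm2 y - qIm2 x * qIm1 y + qIm3 x * qRe y)"

lemmas quat_algebra_defs = one_quat_def times_quat_def

lemma norm_mult_quat: "norm (x * y) = norm x * norm (y :: quat)"
proof (rule power2_eq_imp_eq)
  show "(norm (x * y))\<^sup>2 = (norm x * norm y)\<^sup>2"
    unfolding power_mult_distrib norm_sq_quat times_quat_def quat.sel
    by (simp add: power2_eq_square algebra_simps)
qed simp_all

instance
proof
  show "norm (1 :: quat) = 1"
    by (simp add: one_quat_def norm_eq_sqrt_inner inner_quat_def)
  show "norm (x * y) \<le> norm x * norm y" for x y :: quat
    by (simp add: norm_mult_quat)
qed (simp_all add: quat_algebra_defs quat_vector_defs algebra_simps)

end

definition qcnj :: "quat \<Rightarrow> quat" where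
  "qcnj q = Quat (qRe q) (- qIm1 q) (- qIm2 q) (- qIm3 q)"

lemma mult_qcnj: "x * qcnj x = (norm x)\<^sup>2 *\<^sub>R 1" "qcnj x * x = (norm x)\<^sup>2 *\<^sub>R 1"
  unfolding norm_sq_quat
  by (simp_all add: qcnj_def quat_algebra_defs quat_vector_defs power2_eq_square)

instantiation quat :: real_normed_div_algebra
begin

definition "inverse x = (1 / (norm x)\<^sup>2) *\<^sub>R qcnj x"

definition "x div (y :: quat) = x * inverse y"

instance
proof
  fix x y :: quat
  show "inverse (0 :: quat) = 0"
    by (simp add: inverse_quat_def)
  show "x div y = x * inverse y"
    by (rule divide_quat_def)
  show "norm (x * y) = norm x * norm y"
    by (rule norm_mult_quat)
  assume "x \<noteq> 0"
  then show "inverse x * x = 1" "x * inverse x = 1"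
    by (simp_all add: inverse_quat_def mult_qcnj)
qed

end

definition qIm :: "quat \<Rightarrow> quat" where
  "qIm q = q - of_real (qRe q)"

text \<open>The embedding of the complex numbers as the plane spanned by \<open>1\<close> and \<open>i\<close>.\<close>

definition quat_of_complex :: "complex \<Rightarrow> quat" where
  "quat_of_complex z = Quat (Re z) (Im z) 0 0"

definition imag_units :: "quat set" where
  "imag_units = {m. m\<^sup>2 = -1}"

definition similarity_class :: "quat \<Rightarrow> quat set" where
  "similarity_class q = {of_real (qRe q) + m * of_real (norm (qIm q)) | m. m \<in> imag_units}"

definition circularization :: "complex set \<Rightarrow> quat set" where
  "circularization X =
     {of_real \<alpha> + of_real \<beta> * m | \<alpha> \<beta> m. Complex \<alpha> \<beta> \<in> X \<and> m \<in> imag_units}"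

section \<open>Right quaternionic Hilbert spaces\<close>

text \<open>
  The real vector space structure, the norm and the topology (from class \<open>banach\<close>, which also
  provides completeness) are those induced by the quaternionic structure; this is the content of
  \<open>scaleH_of_real\<close> and \<open>norm_eq_sqrt_hinner\<close>.
\<close>

class right_quat_hilbert = banach +
  fixes scaleH :: "'a \<Rightarrow> quat \<Rightarrow> 'a" (infixl "*\<^sub>H" 75)
    and hinner :: "'a \<Rightarrow> 'a \<Rightarrow> quat"
  assumes scaleH_add_left: "(x + y) *\<^sub>H q = x *\<^sub>H q + y *\<^sub>H q"
    and scaleH_add_right: "x *\<^sub>H (p + q) = x *\<^sub>H p + x *\<^sub>H q"
    and scaleH_scaleH: "(x *\<^sub>H p) *\<^sub>H q = x *\<^sub>H (p * q)"
    and scaleH_one: "x *\<^sub>H 1 = x"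
    and scaleH_of_real: "x *\<^sub>H of_real r = r *\<^sub>R x"
    and hinner_add_right: "hinner x (y + z) = hinner x y + hinner x z"
    and hinner_scaleH_right: "hinner x (y *\<^sub>H q) = hinner x y * q"
    and hinner_commute: "hinner x y = qcnj (hinner y x)"
    and hinner_ge_zero: "0 \<le> qRe (hinner x x)"
    and hinner_eq_zero_iff: "hinner x x = 0 \<longleftrightarrow> x = 0"
    and norm_eq_sqrt_hinner: "norm x = sqrt (qRe (hinner x x))"

text \<open>Density of the right quaternionic span is what makes an orthonormal sequence a (Hilbert) basis.\<close>

definition orthonormal_basis :: "(nat \<Rightarrow> 'a::right_quat_hilbert) \<Rightarrow> bool" where
  "orthonormal_basis e \<longleftrightarrow>
     (\<forall>m n. hinner (e m) (e n) = (if m = n then 1 else 0)) \<and>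
     closure {\<Sum>n\<in>F. e n *\<^sub>H c n | F c. finite F} = UNIV"

definition left_mult_op :: "(nat \<Rightarrow> 'a::right_quat_hilbert) \<Rightarrow> quat \<Rightarrow> 'a \<Rightarrow> 'a" where
  "left_mult_op e q x = (\<Sum>n. e n *\<^sub>H q *\<^sub>H hinner (e n) x)"

section \<open>The S-spectrum and the pseudo S-spectrum\<close>

text \<open>
  Operators are plain functions; the notions below are meant for bounded right linear ones, and
  \<open>onorm\<close> is then the operator norm. The inverse is required to be bounded right linear as well,
  so invertibility is in the algebra of such operators, and \<open>inv\<close> is the inverse there.
\<close>

definition bounded_right_linear :: "('a::right_quat_hilbert \<Rightarrow> 'a) \<Rightarrow> bool" where
  "bounded_right_linear T \<longleftrightarrow> bounded_linear T \<and> (\<forall>x q. T (x *\<^sub>H q) = T x *\<^sub>H q)"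

definition invertible_op :: "('a::right_quat_hilbert \<Rightarrow> 'a) \<Rightarrow> bool" where
  "invertible_op T \<longleftrightarrow> (\<exists>S. bounded_right_linear S \<and> S \<circ> T = id \<and> T \<circ> S = id)"

definition Q_op :: "quat \<Rightarrow> ('a::right_quat_hilbert \<Rightarrow> 'a) \<Rightarrow> 'a \<Rightarrow> 'a" where
  "Q_op p T x = T (T x) - (2 * qRe p) *\<^sub>R T x + (norm p)\<^sup>2 *\<^sub>R x"

definition S_spectrum :: "('a::right_quat_hilbert \<Rightarrow> 'a) \<Rightarrow> quat set" where
  "S_spectrum T = {p. \<not> invertible_op (Q_op p T)}"

definition pseudo_S_spectrum :: "real \<Rightarrow> ('a::right_quat_hilbert \<Rightarrow> 'a) \<Rightarrow> quat set" where
  "pseudo_S_spectrum \<epsilon> T =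
     S_spectrum T \<union> {p. p \<notin> S_spectrum T \<and> onorm (inv (Q_op p T)) \<ge> 1 / \<epsilon>}"

text \<open>
  For the sets of interest (circular, nonempty) the infimum is over a nonempty set of nonnegative
  reals.
\<close>

definition SH :: "quat set \<Rightarrow> real \<Rightarrow> quat set" where
  "SH K \<epsilon> = {p. (INF \<mu>\<in>K \<inter> range quat_of_complex.
                   norm (\<mu>\<^sup>2 - 2 * of_real (qRe p) * \<mu> + of_real ((norm p)\<^sup>2))) \<le> \<epsilon>}"

end

theory Submission
  imports Defs
begin

text \<open>
  The coordinates \<open>\<langle>e\<^sub>n, L\<^sub>q x\<rangle> = q \<langle>e\<^sub>n, x\<rangle>\<close> determine \<open>L\<^sub>q x\<close>, so \<open>q \<mapsto> L\<^sub>q\<close> is a unital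
  homomorphism of real algebras, and \<open>\<parallel>L\<^sub>q x\<parallel> = \<bar>q\<bar> \<parallel>x\<parallel>\<close>. Hence \<open>Q\<^sub>p(L\<^sub>q) = L\<^sub>r\<close> with
  \<open>r = q\<^sup>2 - 2 Re(p) q + \<bar>p\<bar>\<^sup>2\<close>; this is invertible iff \<open>r \<noteq> 0\<close>, and then its inverse has norm
  \<open>1 / \<bar>r\<bar>\<close>. So the pseudo S-spectrum is \<open>{p. \<bar>r\<bar> \<le> \<epsilon>}\<close>. Finally \<open>\<bar>r\<bar>\<close> depends only on the real
  part of \<open>q\<close> and the modulus of its imaginary part, so replacing \<open>q\<close> by any similar \<open>\<mu>\<close> does not
  change it; for real \<open>q\<close> it is \<open>\<bar>p - q\<bar>\<^sup>2\<close>.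
\<close>

section \<open>Quaternions\<close>

lemma quat_sel_simps [simp]:
  "qRe 0 = 0" "qIm1 0 = 0" "qIm2 0 = 0" "qIm3 0 = 0"
  "qRe 1 = 1" "qIm1 1 = 0" "qIm2 1 = 0" "qIm3 1 = 0"
  "qRe (x + y) = qRe x + qRe y" "qIm1 (x + y) = qIm1 x + qIm1 y"
  "qIm2 (x + y) = qIm2 x + qIm2 y" "qIm3 (x + y) = qIm3 x + qIm3 y"
  "qRe (x - y) = qRe x - qRe y" "qIm1 (x - y) = qIm1 x - qIm1 y"
  "qIm2 (x - y) = qIm2 x - qIm2 y" "qIm3 (x - y) = qIm3 x - qIm3 y"
  "qRe (- x) = - qRe x" "qIm1 (- x) = - qIm1 x" "qIm2 (- x) = - qIm2 x" "qIm3 (- x) = - qIm3 x"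
  "qRe (r *\<^sub>R x) = r * qRe x" "qIm1 (r *\<^sub>R x) = r * qIm1 x"
  "qIm2 (r *\<^sub>R x) = r * qIm2 x" "qIm3 (r *\<^sub>R x) = r * qIm3 x"
  by (simp_all add: quat_vector_defs one_quat_def)

lemma of_real_sel_simps [simp]:
  "qRe (of_real r) = r" "qIm1 (of_real r) = 0" "qIm2 (of_real r) = 0" "qIm3 (of_real r) = 0"
  by (simp_all add: of_real_def)

lemma of_real_mult_quat: "of_real r * x = r *\<^sub>R (x :: quat)" "x * of_real r = r *\<^sub>R x"
  by (simp_all add: of_real_def)

section \<open>Imaginary units, similarity classes and circularizations\<close>

lemma norm_qIm_sq: "(norm (qIm q))\<^sup>2 = (qIm1 q)\<^sup>2 + (qIm2 q)\<^sup>2 + (qIm3 q)\<^sup>2"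
  by (simp add: norm_sq_quat qIm_def)

text \<open>Taking norms in \<open>m * m = - 1\<close> gives modulus 1, and its real part says that
  (Re m)^2 minus the squared imaginary components is -1. Adding the two equations leaves Re m = 0.
  Conversely, a purely imaginary \<open>m\<close> squares to -|m|^2.\<close>

lemma imag_units_iff: "m \<in> imag_units \<longleftrightarrow> qRe m = 0 \<and> norm m = 1"
proof
  assume "m \<in> imag_units"
  then have m: "m * m = - 1"
    by (simp add: imag_units_def power2_eq_square)
  have "(norm m)\<^sup>2 = 1"
    using arg_cong[OF m, of norm] by (simp add: norm_mult power2_eq_square)
  then have "norm m = 1"
    using norm_ge_zero[of m] unfolding power2_eq_1_iff by linarith
  moreover from this have "(qRe m)\<^sup>2 + (qIm1 m)\<^sup>2 + (qIm2 m)\<^sup>2 + (qIm3 m)\<^sup>2 = 1"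
    by (simp flip: norm_sq_quat)
  moreover have "(qRe m)\<^sup>2 - (qIm1 m)\<^sup>2 - (qIm2 m)\<^sup>2 - (qIm3 m)\<^sup>2 = - 1"
    using arg_cong[OF m, of qRe] by (simp add: times_quat_def power2_eq_square)
  ultimately have "(qRe m)\<^sup>2 = 0"
    by linarith
  then show "qRe m = 0 \<and> norm m = 1"
    using \<open>norm m = 1\<close> by simp
next
  assume m: "qRe m = 0 \<and> norm m = 1"
  then have "(qIm1 m)\<^sup>2 + (qIm2 m)\<^sup>2 + (qIm3 m)\<^sup>2 = 1"
    using norm_sq_quat[of m] by simp
  then show "m \<in> imag_units"
    using m by (simp add: imag_units_def power2_eq_square quat_eq_iff times_quat_def)
qed

lemma ex_imag_unit_decomp:
  obtains m where "m \<in> imag_units" "q = of_real (qRe q) + of_real (norm (qIm q)) * m"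
proof (cases "qIm q = 0")
  case True
  \<comment> \<open>The coefficient of \<open>m\<close> is 0 here, so any imaginary unit will do;
    this one is i.\<close>
  have "Quat 0 1 0 0 \<in> imag_units"
    by (simp add: imag_units_iff norm_eq_sqrt_inner inner_quat_def)
  moreover have "q = of_real (qRe q)"
    using True by (simp add: qIm_def)
  ultimately show ?thesis
    using True that by simp
next
  case False
  define m where "m = qIm q /\<^sub>R norm (qIm q)"
  have "qRe m = 0"
    by (simp add: m_def qIm_def)
  moreover have "norm m = 1"
    using False by (simp add: m_def)
  moreover have "q = of_real (qRe q) + of_real (norm (qIm q)) * m"
    using False by (simp add: m_def of_real_mult_quat qIm_def)
  ultimately show ?thesis
    using that by (simp add: imag_units_iff)
qed

text \<open>Reduces similarity to the two real invariants on which the norm of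
  \<open>Q_quat p q\<close> will turn out to depend. For the converse, the unit is the direction of
  the imaginary part of \<open>\<mu>\<close> itself.\<close>

lemma similarity_class_iff:
  "\<mu> \<in> similarity_class q \<longleftrightarrow> qRe \<mu> = qRe q \<and> norm (qIm \<mu>) = norm (qIm q)"
proof
  assume "\<mu> \<in> similarity_class q"
  then obtain m where "m \<in> imag_units" "\<mu> = of_real (qRe q) + m * of_real (norm (qIm q))"
    by (auto simp: similarity_class_def)
  then show "qRe \<mu> = qRe q \<and> norm (qIm \<mu>) = norm (qIm q)"
    by (simp add: qIm_def imag_units_iff of_real_mult_quat)
next
  assume eq: "qRe \<mu> = qRe q \<and> norm (qIm \<mu>) = norm (qIm q)"
  obtain m where "m \<in> imag_units" "\<mu> = of_real (qRe \<mu>) + of_real (norm (qIm \<mu>)) * m"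
    by (rule ex_imag_unit_decomp)
  then show "\<mu> \<in> similarity_class q"
    using eq unfolding similarity_class_def of_real_mult_quat by auto
qed

text \<open>As the centre is real, |\<alpha> + \<beta> m - a|^2 = (\<alpha> - a)^2 + \<beta>^2 for
  every imaginary unit \<open>m\<close>, which is the squared distance in the complex plane.\<close>

lemma circularization_cball_of_real:
  "circularization (cball (complex_of_real a) r) = {p. norm (p - of_real a) \<le> r}"
proof -
  have norm_eq: "norm (of_real \<alpha> + of_real \<beta> * m - of_real a) = dist (complex_of_real a) (Complex \<alpha> \<beta>)"
    if "m \<in> imag_units" for \<alpha> \<beta> m
  proof (rule power2_eq_imp_eq)
    have m: "qRe m = 0" "(qIm1 m)\<^sup>2 + (qIm2 m)\<^sup>2 + (qIm3 m)\<^sup>2 = 1"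
      using that norm_sq_quat[of m] by (simp_all add: imag_units_iff)
    have "(norm (of_real \<alpha> + of_real \<beta> * m - of_real a))\<^sup>2
        = (\<alpha> - a)\<^sup>2 + \<beta>\<^sup>2 * ((qIm1 m)\<^sup>2 + (qIm2 m)\<^sup>2 + (qIm3 m)\<^sup>2)"
      using m(1) by (simp add: norm_sq_quat of_real_mult_quat power_mult_distrib algebra_simps)
    also have "\<dots> = (dist (complex_of_real a) (Complex \<alpha> \<beta>))\<^sup>2"
      by (simp add: m(2) dist_norm cmod_power2 power2_commute)
    finally show "(norm (of_real \<alpha> + of_real \<beta> * m - of_real a))\<^sup>2
        = (dist (complex_of_real a) (Complex \<alpha> \<beta>))\<^sup>2" .
  qed simp_all
  show ?thesis
  proof (intro equalityI subsetI)
    fix p :: quat assume "p \<in> {p. norm (p - of_real a) \<le> r}"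
    moreover obtain m where "m \<in> imag_units" "p = of_real (qRe p) + of_real (norm (qIm p)) * m"
      by (rule ex_imag_unit_decomp)
    ultimately show "p \<in> circularization (cball (complex_of_real a) r)"
      using norm_eq[of m "qRe p" "norm (qIm p)"] unfolding circularization_def by auto
  next
    fix p assume "p \<in> circularization (cball (complex_of_real a) r)"
    then show "p \<in> {p. norm (p - of_real a) \<le> r}"
      using norm_eq unfolding circularization_def by force
  qed
qed

section \<open>The scalar counterpart of \<open>Q_op\<close>\<close>

definition Q_quat :: "quat \<Rightarrow> quat \<Rightarrow> quat" where
  "Q_quat p q = q * q - (2 * qRe p) *\<^sub>R q + of_real ((norm p)\<^sup>2)"

text \<open>Passes from the expression in \<open>SH\<close> to the form with real scaling, which
  matches \<open>Q_op\<close> term by term.\<close>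

lemma Q_quat_alt: "q\<^sup>2 - 2 * of_real (qRe p) * q + of_real ((norm p)\<^sup>2) = Q_quat p q"
proof -
  have "2 * of_real (qRe p) * q = (2 * qRe p) *\<^sub>R q"
    by (simp flip: of_real_mult_quat(1))
  then show ?thesis
    by (simp add: Q_quat_def power2_eq_square)
qed

text \<open>Each imaginary component of q^2 is 2 Re q times that of \<open>q\<close>, so the
  imaginary part of \<open>Q_quat p q\<close> is a real multiple of that of \<open>q\<close>. Hence
  only Re q and |Im q| enter the norm.\<close>

lemma norm_Q_quat_sq:
  "(norm (Q_quat p q))\<^sup>2 =
     ((qRe q)\<^sup>2 - (norm (qIm q))\<^sup>2 - 2 * qRe p * qRe q + (norm p)\<^sup>2)\<^sup>2
     + (2 * qRe q - 2 * qRe p)\<^sup>2 * (norm (qIm q))\<^sup>2"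
proof -
  have "qRe (Q_quat p q) = (qRe q)\<^sup>2 - (norm (qIm q))\<^sup>2 - 2 * qRe p * qRe q + (norm p)\<^sup>2"
    unfolding norm_qIm_sq Q_quat_def
    by (simp add: times_quat_def power2_eq_square del: of_real_power of_real_mult)
  moreover have "qIm1 (Q_quat p q) = (2 * qRe q - 2 * qRe p) * qIm1 q"
    "qIm2 (Q_quat p q) = (2 * qRe q - 2 * qRe p) * qIm2 q"
    "qIm3 (Q_quat p q) = (2 * qRe q - 2 * qRe p) * qIm3 q"
    unfolding Q_quat_def by (simp_all add: times_quat_def algebra_simps del: of_real_power)
  ultimately show ?thesis
    unfolding norm_sq_quat[of "Q_quat p q"] by (simp add: norm_qIm_sq power_mult_distrib distrib_left)
qed

lemma norm_Q_quat_of_real: "norm (Q_quat p (of_real a)) = (norm (p - of_real a))\<^sup>2"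
proof (rule power2_eq_imp_eq)
  have "a\<^sup>2 - 2 * qRe p * a + (norm p)\<^sup>2 = (norm (p - of_real a))\<^sup>2"
    by (simp add: norm_sq_quat power2_diff)
  then show "(norm (Q_quat p (of_real a)))\<^sup>2 = ((norm (p - of_real a))\<^sup>2)\<^sup>2"
    by (simp add: norm_Q_quat_sq qIm_def)
qed simp_all

text \<open>The function under the infimum is constant on the similarity class, so the infimum is
  its value at \<open>q\<close> once the index set is known to be nonempty.\<close>

lemma SH_similarity_class: "SH (similarity_class q) \<epsilon> = {p. norm (Q_quat p q) \<le> \<epsilon>}"
proof -
  have "norm (Q_quat p \<mu>) = norm (Q_quat p q)" if "\<mu> \<in> similarity_class q" for \<mu> p
    by (rule power2_eq_imp_eq) (use that in \<open>simp_all add: norm_Q_quat_sq similarity_class_iff\<close>)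
  then have image: "(INF \<mu>\<in>similarity_class q \<inter> range quat_of_complex. norm (Q_quat p \<mu>))
      = (INF \<mu>\<in>similarity_class q \<inter> range quat_of_complex. norm (Q_quat p q))" for p
    by (intro INF_cong) auto
  \<comment> \<open>Nonemptiness: Re q + |Im q| i is a complex representative of the class.\<close>
  have "qRe (quat_of_complex (Complex (qRe q) (norm (qIm q)))) = qRe q"
    by (simp add: quat_of_complex_def)
  moreover have "norm (qIm (quat_of_complex (Complex (qRe q) (norm (qIm q))))) = norm (qIm q)"
    by (rule power2_eq_imp_eq) (simp_all add: quat_of_complex_def norm_qIm_sq)
  ultimately have "similarity_class q \<inter> range quat_of_complex \<noteq> {}"
    using similarity_class_iff by blast
  then show ?thesis
    unfolding SH_def Q_quat_alt image by simp
qed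

section \<open>Orthonormal bases\<close>

lemma qcnj_simps:
  "qcnj (x + y) = qcnj x + qcnj y" "qcnj (x * y) = qcnj y * qcnj x" "qcnj 0 = 0"
  by (simp_all add: quat_eq_iff qcnj_def times_quat_def)

lemma hinner_add_left: "hinner (x + y) z = hinner x z + hinner y (z :: 'a::right_quat_hilbert)"
  unfolding hinner_commute[of _ z] by (simp add: hinner_add_right qcnj_simps)

lemma hinner_scaleH_left: "hinner (x *\<^sub>H q) y = qcnj q * hinner x (y :: 'a::right_quat_hilbert)"
  unfolding hinner_commute[of _ y] by (simp add: hinner_scaleH_right qcnj_simps)

lemma hinner_scaleR_right: "hinner x (r *\<^sub>R y) = r *\<^sub>R hinner x (y :: 'a::right_quat_hilbert)"
  by (simp flip: scaleH_of_real add: hinner_scaleH_right of_real_mult_quat)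

lemma hinner_zero_right [simp]: "hinner x (0 :: 'a::right_quat_hilbert) = 0"
  using hinner_scaleR_right[of x 0 0] by simp

lemma hinner_diff_right: "hinner x (y - z) = hinner x y - hinner x (z :: 'a::right_quat_hilbert)"
  using hinner_add_right[of x "y - z" z] by simp

lemma hinner_sum_right: "hinner x (sum f F) = (\<Sum>n\<in>F. hinner x (f n :: 'a::right_quat_hilbert))"
  by (induction F rule: infinite_finite_induct) (simp_all add: hinner_add_right)

lemma hinner_eq_zero_commute: "hinner x y = 0 \<longleftrightarrow> hinner y (x :: 'a::right_quat_hilbert) = 0"
  using hinner_commute[of x y] hinner_commute[of y x] by (auto simp: qcnj_simps)

lemma norm_sq_hinner: "(norm x)\<^sup>2 = qRe (hinner x (x :: 'a::right_quat_hilbert))"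
  by (simp add: norm_eq_sqrt_hinner hinner_ge_zero)

text \<open>\<open>hinner x x\<close> equals its own conjugate, so it is real and can be moved past
  \<open>q\<close>; what remains is \<open>qcnj q * q\<close>, that is |q|^2.\<close>

lemma norm_scaleH: "norm (x *\<^sub>H q) = norm (x :: 'a::right_quat_hilbert) * norm q"
proof (rule power2_eq_imp_eq)
  have "qcnj (hinner x x) = hinner x x"
    by (rule hinner_commute[symmetric])
  then have "hinner x x = of_real ((norm x)\<^sup>2)"
    by (simp add: norm_sq_hinner quat_eq_iff qcnj_def)
  then have "hinner (x *\<^sub>H q) (x *\<^sub>H q) = (norm x)\<^sup>2 *\<^sub>R (qcnj q * q)"
    by (simp add: hinner_scaleH_left hinner_scaleH_right of_real_def)
  then show "(norm (x *\<^sub>H q))\<^sup>2 = (norm x * norm q)\<^sup>2"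
    by (simp add: norm_sq_hinner[of "x *\<^sub>H q"] mult_qcnj power_mult_distrib)
qed simp_all

lemma hinner_pythagoras:
  assumes "hinner x (y :: 'a::right_quat_hilbert) = 0"
  shows "(norm (x + y))\<^sup>2 = (norm x)\<^sup>2 + (norm y)\<^sup>2"
proof -
  have "hinner y x = 0"
    using assms hinner_eq_zero_commute by blast
  then show ?thesis
    by (simp add: norm_sq_hinner hinner_add_right hinner_add_left assms)
qed

section \<open>Finite expansions, Bessel's inequality and completeness\<close>

locale quat_orthonormal_basis =
  fixes e :: "nat \<Rightarrow> 'a::right_quat_hilbert"
  assumes basis: "orthonormal_basis e"
begin

lemma hinner_basis: "hinner (e m) (e n) = (if m = n then 1 else 0)"
  using basis by (simp add: orthonormal_basis_def)

lemma norm_basis: "norm (e n) = 1"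
  by (simp add: norm_eq_sqrt_hinner hinner_basis)

lemma hinner_basis_sum:
  assumes "finite F"
  shows "hinner (e m) (\<Sum>n\<in>F. e n *\<^sub>H c n) = (if m \<in> F then c m else 0)"
proof -
  have "hinner (e m) (\<Sum>n\<in>F. e n *\<^sub>H c n) = (\<Sum>n\<in>F. if m = n then c n else 0)"
    by (auto simp: hinner_sum_right hinner_scaleH_right hinner_basis intro!: sum.cong)
  then show ?thesis
    using assms by (simp add: sum.delta')
qed

lemma hinner_sum_basis_eq_0:
  assumes "\<And>n. n \<in> F \<Longrightarrow> hinner (e n) x = 0"
  shows "hinner x (\<Sum>n\<in>F. e n *\<^sub>H c n) = 0"
proof -
  have "hinner x (e n *\<^sub>H c n) = 0" if "n \<in> F" for n
    using assms[OF that] hinner_eq_zero_commute[of "e n" x] by (simp add: hinner_scaleH_right)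
  then show ?thesis
    by (simp add: hinner_sum_right)
qed

lemma norm_sum_basis_sq:
  assumes "finite F"
  shows "(norm (\<Sum>n\<in>F. e n *\<^sub>H c n))\<^sup>2 = (\<Sum>n\<in>F. (norm (c n))\<^sup>2)"
  using assms
proof (induction F rule: finite_induct)
  case (insert k F)
  have "hinner (e k *\<^sub>H c k) (\<Sum>n\<in>F. e n *\<^sub>H c n) = 0"
    using insert.hyps by (simp add: hinner_scaleH_left hinner_basis_sum)
  then have "(norm (e k *\<^sub>H c k + (\<Sum>n\<in>F. e n *\<^sub>H c n)))\<^sup>2
      = (norm (e k *\<^sub>H c k))\<^sup>2 + (norm (\<Sum>n\<in>F. e n *\<^sub>H c n))\<^sup>2"
    by (rule hinner_pythagoras)
  then show ?case
    using insert by (simp add: norm_scaleH norm_basis)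
qed simp

text \<open>With \<open>s\<close> the orthogonal projection of \<open>x\<close> onto the span of the
  \<open>e n\<close> for \<open>n\<close> in \<open>F\<close>, Pythagoras applies to x = (x - s) +
  s.\<close>

lemma bessel:
  assumes "finite F"
  shows "(\<Sum>n\<in>F. (norm (hinner (e n) x))\<^sup>2) \<le> (norm x)\<^sup>2"
proof -
  define s where "s = (\<Sum>n\<in>F. e n *\<^sub>H hinner (e n) x)"
  have "hinner (e n) (x - s) = 0" if "n \<in> F" for n
    using assms that by (simp add: hinner_diff_right s_def hinner_basis_sum)
  then have "hinner (x - s) s = 0"
    unfolding s_def by (intro hinner_sum_basis_eq_0) (simp flip: s_def)
  then have "(norm (x - s + s))\<^sup>2 = (norm (x - s))\<^sup>2 + (norm s)\<^sup>2"
    by (rule hinner_pythagoras)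
  then show ?thesis
    using norm_sum_basis_sq[OF assms, of "\<lambda>n. hinner (e n) x"] by (simp add: s_def)
qed

lemma norm_hinner_basis_le: "norm (hinner (e n) x) \<le> norm x"
  by (rule power2_le_imp_le) (use bessel[of "{n}" x] in simp_all)

lemma bounded_linear_hinner_basis: "bounded_linear (hinner (e n))"
  by (rule bounded_linear_intro[where K = 1])
    (simp_all add: hinner_add_right hinner_scaleR_right norm_hinner_basis_le)

text \<open>Such an \<open>x\<close> is orthogonal to the span of \<open>e\<close>, so its distance to this dense set is \<open>norm x\<close>.\<close>

lemma basis_complete:
  assumes "\<And>n. hinner (e n) x = 0"
  shows "x = 0"
proof (rule ccontr)
  assume "x \<noteq> 0"
  have "x \<in> closure {\<Sum>n\<in>F. e n *\<^sub>H c n | F c. finite F}"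
    using basis by (simp add: orthonormal_basis_def)
  then obtain y where "y \<in> {\<Sum>n\<in>F. e n *\<^sub>H c n | F c. finite F}" "dist y x < norm x"
    using \<open>x \<noteq> 0\<close> unfolding closure_approachable zero_less_norm_iff[symmetric] by blast
  then obtain F c where y: "y = (\<Sum>n\<in>F. e n *\<^sub>H c n)"
    by blast
  have "hinner x y = 0"
    unfolding y by (rule hinner_sum_basis_eq_0) (rule assms)
  then have "hinner x (- y) = 0"
    using hinner_diff_right[of x 0 y] by simp
  then have "(norm (x + - y))\<^sup>2 = (norm x)\<^sup>2 + (norm (- y))\<^sup>2"
    by (rule hinner_pythagoras)
  then have "(norm x)\<^sup>2 \<le> (norm (x - y))\<^sup>2"
    by simp
  then have "norm x \<le> norm (x - y)"
    by (rule power2_le_imp_le) simp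
  then show False
    using \<open>dist y x < norm x\<close> by (simp add: dist_norm norm_minus_commute)
qed

text \<open>The main tool below: it reduces operator identities to identities between quaternionic
  coordinates.\<close>

lemma basis_ext:
  assumes "\<And>n. hinner (e n) x = hinner (e n) y"
  shows "x = y"
  using basis_complete[of "x - y"] assms by (simp add: hinner_diff_right)

section \<open>Left multiplication operators\<close>

text \<open>Bessel makes the squared moduli of the coordinates summable. A block of the vector
  series has squared norm |q|^2 times the matching block of that real series, so the Cauchy
  criterion carries over and completeness gives convergence.\<close>

lemma summable_left_mult: "summable (\<lambda>n. e n *\<^sub>H q *\<^sub>H hinner (e n) x)"
proof (cases "q = 0")
  case True
  then have "e n *\<^sub>H q *\<^sub>H hinner (e n) x = 0" for n
    using norm_scaleH[of "e n *\<^sub>H q" "hinner (e n) x"] norm_scaleH[of "e n" q] by simp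
  then show ?thesis
    by simp
next
  case False
  have "summable (\<lambda>n. (norm (hinner (e n) x))\<^sup>2)"
    by (rule summableI_nonneg_bounded[where x = "(norm x)\<^sup>2"]) (auto simp: bessel)
  then have cauchy: "\<exists>N. \<forall>m\<ge>N. \<forall>n. norm (\<Sum>i=m..<n. (norm (hinner (e i) x))\<^sup>2) < r" if "r > 0" for r
    using that unfolding summable_Cauchy by blast
  show ?thesis
    unfolding summable_Cauchy
  proof (intro allI impI)
    fix r :: real assume "r > 0"
    \<comment> \<open>This tolerance for the real series becomes r^2 after multiplication by |q|^2;
      hence the separate case \<open>q = 0\<close>.\<close>
    with False have "(r / norm q)\<^sup>2 > 0"
      by simp
    then obtain N where N: "\<forall>m\<ge>N. \<forall>n. norm (\<Sum>i=m..<n. (norm (hinner (e i) x))\<^sup>2) < (r / norm q)\<^sup>2"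
      using cauchy by blast
    have "norm (\<Sum>i=m..<n. e i *\<^sub>H q *\<^sub>H hinner (e i) x) < r" if "m \<ge> N" for m n
    proof (rule power2_less_imp_less)
      have "(norm (\<Sum>i=m..<n. e i *\<^sub>H q *\<^sub>H hinner (e i) x))\<^sup>2
          = (norm q)\<^sup>2 * (\<Sum>i=m..<n. (norm (hinner (e i) x))\<^sup>2)"
        by (simp add: scaleH_scaleH norm_sum_basis_sq norm_mult power_mult_distrib sum_distrib_left)
      also have "\<dots> < (norm q)\<^sup>2 * (r / norm q)\<^sup>2"
        using False N that by (intro mult_strict_left_mono) (auto simp: abs_less_iff)
      also have "\<dots> = r\<^sup>2"
        using False by (simp add: power_divide)
      finally show "(norm (\<Sum>i=m..<n. e i *\<^sub>H q *\<^sub>H hinner (e i) x))\<^sup>2 < r\<^sup>2" .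
    qed (use \<open>r > 0\<close> in simp)
    then show "\<exists>N. \<forall>m\<ge>N. \<forall>n. norm (\<Sum>i=m..<n. e i *\<^sub>H q *\<^sub>H hinner (e i) x) < r"
      by blast
  qed
qed

text \<open>The coordinate functional is continuous, so it passes through the series, and
  orthonormality leaves the single term n = m.\<close>

lemma hinner_left_mult: "hinner (e m) (left_mult_op e q x) = q * hinner (e m) x"
proof -
  have "hinner (e m) (left_mult_op e q x) = (\<Sum>n. hinner (e m) (e n *\<^sub>H q *\<^sub>H hinner (e n) x))"
    unfolding left_mult_op_def
    by (rule bounded_linear.suminf[OF bounded_linear_hinner_basis summable_left_mult])
  also have "\<dots> = (\<Sum>n. if n = m then q * hinner (e n) x else 0)"
    by (intro suminf_cong) (simp add: scaleH_scaleH hinner_scaleH_right hinner_basis)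
  also have "\<dots> = q * hinner (e m) x"
    using sums_single[of m "\<lambda>n. q * hinner (e n) x"] sums_unique by force
  finally show ?thesis .
qed

lemma left_mult_left_mult: "left_mult_op e p (left_mult_op e q x) = left_mult_op e (p * q) x"
  by (rule basis_ext) (simp add: hinner_left_mult mult.assoc)

lemma left_mult_one: "left_mult_op e 1 x = x"
  by (rule basis_ext) (simp add: hinner_left_mult)

lemma left_mult_zero: "left_mult_op e 0 x = 0"
  by (rule basis_ext) (simp add: hinner_left_mult)

text \<open>Bessel bounds every partial sum, and the bound survives the limit.\<close>

lemma norm_left_mult_le: "norm (left_mult_op e q x) \<le> norm q * norm x"
proof -
  have "norm (\<Sum>n<N. e n *\<^sub>H q *\<^sub>H hinner (e n) x) \<le> norm q * norm x" for N
  proof (rule power2_le_imp_le)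
    have "(norm (\<Sum>n<N. e n *\<^sub>H q *\<^sub>H hinner (e n) x))\<^sup>2
        = (norm q)\<^sup>2 * (\<Sum>n<N. (norm (hinner (e n) x))\<^sup>2)"
      by (simp add: scaleH_scaleH norm_sum_basis_sq norm_mult power_mult_distrib sum_distrib_left)
    also have "\<dots> \<le> (norm q * norm x)\<^sup>2"
      by (simp add: power_mult_distrib mult_left_mono bessel)
    finally show "(norm (\<Sum>n<N. e n *\<^sub>H q *\<^sub>H hinner (e n) x))\<^sup>2 \<le> (norm q * norm x)\<^sup>2" .
  qed simp
  moreover have "(\<lambda>N. norm (\<Sum>n<N. e n *\<^sub>H q *\<^sub>H hinner (e n) x)) \<longlonglongrightarrow> norm (left_mult_op e q x)"
    unfolding left_mult_op_def by (intro tendsto_norm summable_LIMSEQ summable_left_mult)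
  ultimately show ?thesis
    by (intro LIMSEQ_le_const2) auto
qed

text \<open>The lower bound is the upper bound for \<open>inverse q\<close> applied to the vector
  \<open>left_mult_op e q x\<close>, which gives equality without Parseval's identity.\<close>

lemma norm_left_mult: "norm (left_mult_op e q x) = norm q * norm x"
proof (cases "q = 0")
  case False
  have "norm x = norm (left_mult_op e (inverse q) (left_mult_op e q x))"
    using False by (simp add: left_mult_left_mult left_mult_one)
  also have "\<dots> \<le> norm (inverse q) * norm (left_mult_op e q x)"
    by (rule norm_left_mult_le)
  finally have "norm q * norm x \<le> norm (left_mult_op e q x)"
    unfolding norm_inverse using False by (simp add: field_simps)
  then show ?thesis
    using norm_left_mult_le[of q x] by simp
qed (simp add: left_mult_zero)

lemma bounded_right_linear_left_mult: "bounded_right_linear (left_mult_op e q)"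
  unfolding bounded_right_linear_def
proof (intro conjI allI)
  show "bounded_linear (left_mult_op e q)"
  proof (rule bounded_linear_intro[where K = "norm q"])
    show "left_mult_op e q (x + y) = left_mult_op e q x + left_mult_op e q y" for x y
      by (rule basis_ext) (simp add: hinner_left_mult hinner_add_right distrib_left)
    show "left_mult_op e q (r *\<^sub>R x) = r *\<^sub>R left_mult_op e q x" for r x
      by (rule basis_ext) (simp add: hinner_left_mult hinner_scaleR_right)
    show "norm (left_mult_op e q x) \<le> norm x * norm q" for x
      by (simp add: norm_left_mult)
  qed
  show "left_mult_op e q (x *\<^sub>H p) = left_mult_op e q x *\<^sub>H p" for x p
    by (rule basis_ext) (simp add: hinner_left_mult hinner_scaleH_right mult.assoc)
qed

section \<open>Operator norm, inverses and the pseudo S-spectrum\<close>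

lemma onorm_left_mult: "onorm (left_mult_op e q) = norm q"
proof (rule antisym)
  show "onorm (left_mult_op e q) \<le> norm q"
    by (rule onorm_bound) (simp_all add: norm_left_mult)
  have "bounded_linear (left_mult_op e q)"
    using bounded_right_linear_left_mult by (simp add: bounded_right_linear_def)
  from onorm[OF this, of "e 0"] show "norm q \<le> onorm (left_mult_op e q)"
    by (simp add: norm_left_mult norm_basis)
qed

lemma left_mult_inverse_comp:
  assumes "q \<noteq> 0"
  shows "left_mult_op e (inverse q) \<circ> left_mult_op e q = id"
    and "left_mult_op e q \<circ> left_mult_op e (inverse q) = id"
  using assms by (simp_all add: fun_eq_iff left_mult_left_mult left_mult_one)

lemma invertible_left_mult_iff: "invertible_op (left_mult_op e q) \<longleftrightarrow> q \<noteq> 0"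
proof
  assume "invertible_op (left_mult_op e q)"
  then obtain S where "S \<circ> left_mult_op e q = id"
    by (auto simp: invertible_op_def)
  \<comment> \<open>If \<open>q\<close> were 0, \<open>S\<close> would have to send 0 both to
    \<open>e 0\<close> and to 0.\<close>
  then have "S (left_mult_op e q (e 0)) = e 0" "S (left_mult_op e q 0) = 0"
    by (metis comp_apply id_apply)+
  moreover have "e 0 \<noteq> 0"
    using norm_basis[of 0] by auto
  ultimately show "q \<noteq> 0"
    by (auto simp: left_mult_zero)
next
  assume "q \<noteq> 0"
  then show "invertible_op (left_mult_op e q)"
    unfolding invertible_op_def
    using bounded_right_linear_left_mult left_mult_inverse_comp by blast
qed

lemma inv_left_mult:
  assumes "q \<noteq> 0"
  shows "inv (left_mult_op e q) = left_mult_op e (inverse q)"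
  by (rule inv_unique_comp) (simp_all add: left_mult_inverse_comp assms)

text \<open>In each coordinate both sides multiply by the same quaternion on the left, since the
  coefficients of \<open>Q_op\<close> are real.\<close>

lemma Q_op_left_mult: "Q_op p (left_mult_op e q) = left_mult_op e (Q_quat p q)"
proof (rule ext, rule basis_ext)
  fix x n
  show "hinner (e n) (Q_op p (left_mult_op e q) x) = hinner (e n) (left_mult_op e (Q_quat p q) x)"
    unfolding Q_op_def Q_quat_def hinner_left_mult hinner_add_right hinner_diff_right
      hinner_scaleR_right
    by (simp add: distrib_right left_diff_distrib mult.assoc of_real_mult_quat del: of_real_power)
qed

lemma pseudo_S_spectrum_left_mult:
  assumes "\<epsilon> > 0"
  shows "pseudo_S_spectrum \<epsilon> (left_mult_op e q) = {p. norm (Q_quat p q) \<le> \<epsilon>}"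
proof (intro set_eqI)
  fix p
  show "p \<in> pseudo_S_spectrum \<epsilon> (left_mult_op e q) \<longleftrightarrow> p \<in> {p. norm (Q_quat p q) \<le> \<epsilon>}"
  \<comment> \<open>If it vanishes, \<open>p\<close> lies in the S-spectrum and 0 \<le> \<epsilon>;
    otherwise the inverse has norm 1 / |\<open>Q_quat p q\<close>|, and the two inequalities are
    reciprocal.\<close>
  proof (cases "Q_quat p q = 0")
    case True
    then show ?thesis
      using assms
      by (simp add: pseudo_S_spectrum_def S_spectrum_def Q_op_left_mult invertible_left_mult_iff)
  next
    case False
    then have "1 / \<epsilon> \<le> inverse (norm (Q_quat p q)) \<longleftrightarrow> norm (Q_quat p q) \<le> \<epsilon>"
      using assms by (simp add: field_simps)
    then show ?thesis
      using False
      by (simp add: pseudo_S_spectrum_def S_spectrum_def Q_op_left_mult invertible_left_mult_iff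
          inv_left_mult onorm_left_mult norm_inverse)
  qed
qed

end

theorem proposition4p12:
  fixes e :: "nat \<Rightarrow> 'a::right_quat_hilbert" and q :: quat and \<epsilon> :: real
  assumes "separable_space (euclidean :: 'a topology)"
    and "orthonormal_basis e"
    and "\<epsilon> > 0"
  shows "pseudo_S_spectrum \<epsilon> (left_mult_op e q) = SH (similarity_class q) \<epsilon> \<and>
         (q \<in> \<real> \<longrightarrow>
           pseudo_S_spectrum \<epsilon> (left_mult_op e q) =
           circularization (cball (complex_of_real (qRe q)) (sqrt \<epsilon>)))"
proof -
  interpret quat_orthonormal_basis e
    by standard (rule assms)
  note spectrum = pseudo_S_spectrum_left_mult[OF \<open>\<epsilon> > 0\<close>]
  have "{p. norm (Q_quat p q) \<le> \<epsilon>} = circularization (cball (complex_of_real (qRe q)) (sqrt \<epsilon>))"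
    if "q \<in> \<real>"
  proof -
    \<comment> \<open>For real \<open>q\<close> the left norm is |p - q|^2, so taking square roots
      turns the bound \<epsilon> into the radius \<open>sqrt \<epsilon>\<close>.\<close>
    have "norm (Q_quat p q) \<le> \<epsilon> \<longleftrightarrow> norm (p - of_real (qRe q)) \<le> sqrt \<epsilon>" for p
      using that norm_Q_quat_of_real[of p "qRe q"]
        real_sqrt_le_iff[of "(norm (p - of_real (qRe q)))\<^sup>2" \<epsilon>]
      by (auto elim!: Reals_cases)
    then show ?thesis
      by (simp add: circularization_cball_of_real)
  qed
  then show ?thesis
    by (simp add: spectrum SH_similarity_class)
qed

end
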